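(* Let $R$ be a commutative ring with $q\text{-}\dim(R)=0$. Then the following statements hold. (1) $R/\mathrm{Nil}(R)$ is a $\tau_q$-von Neumann regular ring. (2) The minimal prime spectrum $\mathrm{Min}(R)$ is compact.
   Context: All rings are commutative with identity. $\mathrm{Nil}(R)$ is the nilradical of $R$, and $\mathrm{Min}(R)$ is the set of minimal prime ideals of $R$ with the topology induced by the Zariski topology on $\mathrm{Spec}(R)$. An ideal $I$ of $R$ is dense if $(0:_R I)=0$, and semi-regular if it contains a finitely generated dense ideal of $R$. Let $\mathcal{Q}$ be the set of all finitely generated semi-regular ideals of $R$. For an ideal $I$ of $R$ put $I_q=\{x\in \mathrm{E}_R(R)\mid Jx\subseteq I \text{ for some } J\in\mathcal{Q}\}$, where $\mathrm{E}_R(R)$ is the injective envelope of $R$ as an $R$-module. The ideal $I$ is a $q$-ideal if $I_q\cap R=I$. A maximal $q$-ideal is an ideal maximal among the proper $q$-ideals of $R$; the set of maximal $q$-ideals is denoted $q\text{-}\mathrm{Max}(R)$. It coincides with the set of ideals maximal among the non-semi-regular ideals of $R$, and consists of prime ideals. The $q$-Krull dimension of $R$ is $q\text{-}\dim(R)=\sup\{\mathrm{ht}(\mathfrak{p})\mid \mathfrak{p}\in q\text{-}\mathrm{Max}(R)\}$. A ring $S$ is called $\tau_q$-von Neumann regular if the localization $S_{\mathfrak{m}}$ is a von Neumann regular ring for every $\mathfrak{m}\in q\text{-}\mathrm{Max}(S)$. *)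

theory Defs
  imports
    "HOL-Algebra.QuotRing"
    "HOL-Algebra.Multiplicative_Group"
    "HOL-Algebra.Module"
    "HOL-Analysis.Abstract_Topology"
    "HOL-Library.Extended_Nat"
begin

section \<open>Nilradical and von Neumann regular rings\<close>

definition nilradical :: "('a, 'b) ring_scheme \<Rightarrow> 'a set" where
  "nilradical R = {x \<in> carrier R. \<exists>n::nat. x [^]\<^bsub>R\<^esub> n = \<zero>\<^bsub>R\<^esub>}"

definition von_neumann_regular :: "('a, 'b) ring_scheme \<Rightarrow> bool" where
  "von_neumann_regular R \<longleftrightarrow>
     cring R \<and> (\<forall>a\<in>carrier R. \<exists>x\<in>carrier R. a \<otimes>\<^bsub>R\<^esub> x \<otimes>\<^bsub>R\<^esub> a = a)"


section \<open>Localization\<close>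

definition loc_rel :: "('a, 'b) ring_scheme \<Rightarrow> 'a set \<Rightarrow> (('a \<times> 'a) \<times> ('a \<times> 'a)) set" where
  "loc_rel R S =
     {((a, s), (b, t)) | a s b t.
        a \<in> carrier R \<and> s \<in> S \<and> b \<in> carrier R \<and> t \<in> S \<and>
        (\<exists>u\<in>S. u \<otimes>\<^bsub>R\<^esub> (t \<otimes>\<^bsub>R\<^esub> a \<ominus>\<^bsub>R\<^esub> s \<otimes>\<^bsub>R\<^esub> b) = \<zero>\<^bsub>R\<^esub>)}"

text \<open>The fraction a/s, as a class of pairs.\<close>

definition loc_frac :: "('a, 'b) ring_scheme \<Rightarrow> 'a set \<Rightarrow> 'a \<Rightarrow> 'a \<Rightarrow> ('a \<times> 'a) set" where
  "loc_frac R S a s = loc_rel R S `` {(a, s)}"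

text \<open>
  The operations take the union over all representatives of the resulting fraction; for a
  multiplicative set this union is a single class, see \<open>loc_mult_frac\<close> and \<open>loc_add_frac\<close> below.
\<close>

definition localization :: "('a, 'b) ring_scheme \<Rightarrow> 'a set \<Rightarrow> (('a \<times> 'a) set) ring" where
  "localization R S =
     \<lparr> carrier = (carrier R \<times> S) // loc_rel R S,
       mult = (\<lambda>X Y. \<Union>(a, s)\<in>X. \<Union>(b, t)\<in>Y. loc_frac R S (a \<otimes>\<^bsub>R\<^esub> b) (s \<otimes>\<^bsub>R\<^esub> t)),
       one = loc_frac R S \<one>\<^bsub>R\<^esub> \<one>\<^bsub>R\<^esub>,
       zero = loc_frac R S \<zero>\<^bsub>R\<^esub> \<one>\<^bsub>R\<^esub>,
       add = (\<lambda>X Y. \<Union>(a, s)\<in>X. \<Union>(b, t)\<in>Y.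
                loc_frac R S (t \<otimes>\<^bsub>R\<^esub> a \<oplus>\<^bsub>R\<^esub> s \<otimes>\<^bsub>R\<^esub> b) (s \<otimes>\<^bsub>R\<^esub> t)) \<rparr>"

definition localization_at :: "('a, 'b) ring_scheme \<Rightarrow> 'a set \<Rightarrow> (('a \<times> 'a) set) ring" where
  "localization_at R P = localization R (carrier R - P)"

locale mult_subset = cring +
  fixes S
  assumes S_sub: "S \<subseteq> carrier R"
    and S_one: "\<one> \<in> S"
    and S_mult: "\<lbrakk>s \<in> S; t \<in> S\<rbrakk> \<Longrightarrow> s \<otimes> t \<in> S"
begin

lemma S_carr: "s \<in> S \<Longrightarrow> s \<in> carrier R"
  using S_sub by blast

lemma loc_rel_iff:
  assumes "a \<in> carrier R" "s \<in> S" "b \<in> carrier R" "t \<in> S"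
  shows "((a, s), (b, t)) \<in> loc_rel R S \<longleftrightarrow> (\<exists>u\<in>S. u \<otimes> (t \<otimes> a) = u \<otimes> (s \<otimes> b))"
proof -
  have "u \<otimes> (t \<otimes> a \<ominus> s \<otimes> b) = \<zero> \<longleftrightarrow> u \<otimes> (t \<otimes> a) = u \<otimes> (s \<otimes> b)" if "u \<in> S" for u
  proof -
    have "u \<otimes> (t \<otimes> a \<ominus> s \<otimes> b) = u \<otimes> (t \<otimes> a) \<ominus> u \<otimes> (s \<otimes> b)"
      using assms that S_carr by (simp add: a_minus_def r_distr r_minus)
    then show ?thesis
      using assms that S_carr by simp
  qed
  then show ?thesis
    using assms by (auto simp: loc_rel_def)
qed

lemma loc_rel_refl: "\<lbrakk>a \<in> carrier R; s \<in> S\<rbrakk> \<Longrightarrow> ((a, s), (a, s)) \<in> loc_rel R S"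
  using S_one by (auto simp: loc_rel_iff)

lemma equiv_loc_rel: "equiv (carrier R \<times> S) (loc_rel R S)"
proof (rule equivI)
  show "loc_rel R S \<subseteq> (carrier R \<times> S) \<times> (carrier R \<times> S)"
    by (auto simp: loc_rel_def)
  show "refl_on (carrier R \<times> S) (loc_rel R S)"
    by (auto simp: refl_on_def loc_rel_refl)
  show "sym (loc_rel R S)"
  proof (rule symI)
    fix x y assume xy: "(x, y) \<in> loc_rel R S"
    obtain a s b t where "x = (a, s)" "y = (b, t)" by (metis surj_pair)
    moreover from this xy have "a \<in> carrier R" "s \<in> S" "b \<in> carrier R" "t \<in> S"
      by (auto simp: loc_rel_def)
    ultimately show "(y, x) \<in> loc_rel R S"
      using xy loc_rel_iff by metis
  qed
  show "trans (loc_rel R S)"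
  proof (rule transI)
    fix x y z assume xy: "(x, y) \<in> loc_rel R S" and yz: "(y, z) \<in> loc_rel R S"
    obtain a s b t c r where e: "x = (a, s)" "y = (b, t)" "z = (c, r)" by (metis surj_pair)
    with xy yz have *: "a \<in> carrier R" "s \<in> S" "b \<in> carrier R" "t \<in> S" "c \<in> carrier R" "r \<in> S"
      by (auto simp: loc_rel_def)
    obtain u where u: "u \<in> S" "u \<otimes> (t \<otimes> a) = u \<otimes> (s \<otimes> b)"
      using xy loc_rel_iff[OF *(1,2,3,4)] e by auto
    obtain v where v: "v \<in> S" "v \<otimes> (r \<otimes> b) = v \<otimes> (t \<otimes> c)"
      using yz loc_rel_iff[OF *(3,4,5,6)] e by auto
    note carr = * u(1) v(1) S_carr
    have "(u \<otimes> v \<otimes> t) \<otimes> (r \<otimes> a) = (v \<otimes> r) \<otimes> (u \<otimes> (t \<otimes> a))"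
      using carr by (simp add: m_ac)
    also have "\<dots> = (v \<otimes> r) \<otimes> (u \<otimes> (s \<otimes> b))"
      by (simp only: u)
    also have "\<dots> = (u \<otimes> s) \<otimes> (v \<otimes> (r \<otimes> b))"
      using carr by (simp add: m_ac)
    also have "\<dots> = (u \<otimes> s) \<otimes> (v \<otimes> (t \<otimes> c))"
      by (simp only: v)
    also have "\<dots> = (u \<otimes> v \<otimes> t) \<otimes> (s \<otimes> c)"
      using carr by (simp add: m_ac)
    finally have "(u \<otimes> v \<otimes> t) \<otimes> (r \<otimes> a) = (u \<otimes> v \<otimes> t) \<otimes> (s \<otimes> c)" .
    moreover have "u \<otimes> v \<otimes> t \<in> S" using carr S_mult by blast
    ultimately show "(x, z) \<in> loc_rel R S"
      using loc_rel_iff[OF *(1,2,5,6)] e by blast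
  qed
qed

lemma loc_frac_eq_iff:
  assumes "a \<in> carrier R" "s \<in> S" "b \<in> carrier R" "t \<in> S"
  shows "loc_frac R S a s = loc_frac R S b t \<longleftrightarrow> (\<exists>u\<in>S. u \<otimes> (t \<otimes> a) = u \<otimes> (s \<otimes> b))"
  using eq_equiv_class_iff[OF equiv_loc_rel, of "(a, s)" "(b, t)"] assms
  by (simp add: loc_frac_def loc_rel_iff)

lemma loc_frac_mem:
  assumes "p \<in> loc_frac R S a s"
  obtains b t where "p = (b, t)" "b \<in> carrier R" "t \<in> S" "a \<in> carrier R" "s \<in> S"
    "loc_frac R S b t = loc_frac R S a s"
proof -
  obtain b t where p: "p = (b, t)" by (metis surj_pair)
  with assms have rel: "((a, s), (b, t)) \<in> loc_rel R S" by (simp add: loc_frac_def)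
  moreover from rel have "b \<in> carrier R" "t \<in> S" "a \<in> carrier R" "s \<in> S"
    by (auto simp: loc_rel_def)
  moreover have "loc_frac R S b t = loc_frac R S a s"
    using equiv_class_eq[OF equiv_loc_rel rel] by (simp add: loc_frac_def)
  ultimately show thesis using that p by blast
qed

lemma loc_frac_self: "\<lbrakk>a \<in> carrier R; s \<in> S\<rbrakk> \<Longrightarrow> (a, s) \<in> loc_frac R S a s"
  by (simp add: loc_frac_def loc_rel_refl)

lemma carrier_localization:
  "carrier (localization R S) = {loc_frac R S a s | a s. a \<in> carrier R \<and> s \<in> S}"
  by (auto simp: localization_def quotient_def loc_frac_def)

lemma loc_mult_frac:
  assumes "a \<in> carrier R" "s \<in> S" "b \<in> carrier R" "t \<in> S"
  shows "loc_frac R S a s \<otimes>\<^bsub>localization R S\<^esub> loc_frac R S b t = loc_frac R S (a \<otimes> b) (s \<otimes> t)"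
proof -
  have "loc_frac R S (a' \<otimes> b') (s' \<otimes> t') = loc_frac R S (a \<otimes> b) (s \<otimes> t)"
    if "(a', s') \<in> loc_frac R S a s" "(b', t') \<in> loc_frac R S b t" for a' s' b' t'
  proof -
    have *: "a' \<in> carrier R" "s' \<in> S" "loc_frac R S a' s' = loc_frac R S a s"
      "b' \<in> carrier R" "t' \<in> S" "loc_frac R S b' t' = loc_frac R S b t"
      using that by (auto elim: loc_frac_mem)
    obtain u where u: "u \<in> S" "u \<otimes> (s \<otimes> a') = u \<otimes> (s' \<otimes> a)"
      using * assms by (auto simp: loc_frac_eq_iff)
    obtain v where v: "v \<in> S" "v \<otimes> (t \<otimes> b') = v \<otimes> (t' \<otimes> b)"
      using * assms by (auto simp: loc_frac_eq_iff)
    note carr = *(1,2,4,5) u(1) v(1) assms S_carr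
    have "(u \<otimes> v) \<otimes> ((s \<otimes> t) \<otimes> (a' \<otimes> b')) = (u \<otimes> (s \<otimes> a')) \<otimes> (v \<otimes> (t \<otimes> b'))"
      using carr by (simp add: m_ac)
    also have "\<dots> = (u \<otimes> (s' \<otimes> a)) \<otimes> (v \<otimes> (t' \<otimes> b))"
      by (simp only: u v)
    also have "\<dots> = (u \<otimes> v) \<otimes> ((s' \<otimes> t') \<otimes> (a \<otimes> b))"
      using carr by (simp add: m_ac)
    finally have "\<exists>w\<in>S. w \<otimes> ((s \<otimes> t) \<otimes> (a' \<otimes> b')) = w \<otimes> ((s' \<otimes> t') \<otimes> (a \<otimes> b))"
      using S_mult u(1) v(1) by blast
    then show ?thesis
      using loc_frac_eq_iff[of "a' \<otimes> b'" "s' \<otimes> t'" "a \<otimes> b" "s \<otimes> t"] carr S_mult by simp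
  qed
  then have "(\<Union>(a', s')\<in>loc_frac R S a s. \<Union>(b', t')\<in>loc_frac R S b t.
      loc_frac R S (a' \<otimes> b') (s' \<otimes> t')) = loc_frac R S (a \<otimes> b) (s \<otimes> t)"
    using loc_frac_self[OF assms(1,2)] loc_frac_self[OF assms(3,4)] by fast
  then show ?thesis
    by (simp add: localization_def)
qed

lemma loc_add_frac:
  assumes "a \<in> carrier R" "s \<in> S" "b \<in> carrier R" "t \<in> S"
  shows "loc_frac R S a s \<oplus>\<^bsub>localization R S\<^esub> loc_frac R S b t
    = loc_frac R S (t \<otimes> a \<oplus> s \<otimes> b) (s \<otimes> t)"
proof -
  have "loc_frac R S (t' \<otimes> a' \<oplus> s' \<otimes> b') (s' \<otimes> t') = loc_frac R S (t \<otimes> a \<oplus> s \<otimes> b) (s \<otimes> t)"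
    if "(a', s') \<in> loc_frac R S a s" "(b', t') \<in> loc_frac R S b t" for a' s' b' t'
  proof -
    have *: "a' \<in> carrier R" "s' \<in> S" "loc_frac R S a' s' = loc_frac R S a s"
      "b' \<in> carrier R" "t' \<in> S" "loc_frac R S b' t' = loc_frac R S b t"
      using that by (auto elim: loc_frac_mem)
    obtain u where u: "u \<in> S" "u \<otimes> (s \<otimes> a') = u \<otimes> (s' \<otimes> a)"
      using * assms by (auto simp: loc_frac_eq_iff)
    obtain v where v: "v \<in> S" "v \<otimes> (t \<otimes> b') = v \<otimes> (t' \<otimes> b)"
      using * assms by (auto simp: loc_frac_eq_iff)
    note carr = *(1,2,4,5) u(1) v(1) assms S_carr
    have "(u \<otimes> v) \<otimes> ((s \<otimes> t) \<otimes> (t' \<otimes> a' \<oplus> s' \<otimes> b'))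
        = (v \<otimes> t \<otimes> t') \<otimes> (u \<otimes> (s \<otimes> a')) \<oplus> (u \<otimes> s \<otimes> s') \<otimes> (v \<otimes> (t \<otimes> b'))"
      using carr by (simp add: m_ac r_distr)
    also have "\<dots> = (v \<otimes> t \<otimes> t') \<otimes> (u \<otimes> (s' \<otimes> a)) \<oplus> (u \<otimes> s \<otimes> s') \<otimes> (v \<otimes> (t' \<otimes> b))"
      by (simp only: u v)
    also have "\<dots> = (u \<otimes> v) \<otimes> ((s' \<otimes> t') \<otimes> (t \<otimes> a \<oplus> s \<otimes> b))"
      using carr by (simp add: m_ac r_distr)
    finally have "\<exists>w\<in>S. w \<otimes> ((s \<otimes> t) \<otimes> (t' \<otimes> a' \<oplus> s' \<otimes> b'))
        = w \<otimes> ((s' \<otimes> t') \<otimes> (t \<otimes> a \<oplus> s \<otimes> b))"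
      using S_mult u(1) v(1) by blast
    then show ?thesis
      using loc_frac_eq_iff[of "t' \<otimes> a' \<oplus> s' \<otimes> b'" "s' \<otimes> t'" "t \<otimes> a \<oplus> s \<otimes> b" "s \<otimes> t"]
        carr S_mult by simp
  qed
  then have "(\<Union>(a', s')\<in>loc_frac R S a s. \<Union>(b', t')\<in>loc_frac R S b t.
      loc_frac R S (t' \<otimes> a' \<oplus> s' \<otimes> b') (s' \<otimes> t')) = loc_frac R S (t \<otimes> a \<oplus> s \<otimes> b) (s \<otimes> t)"
    using loc_frac_self[OF assms(1,2)] loc_frac_self[OF assms(3,4)] by fast
  then show ?thesis
    by (simp add: localization_def)
qed

end

lemma mult_subset_prime_compl:
  assumes "primeideal P R"
  shows "mult_subset R (carrier R - P)"
proof -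
  interpret primeideal P R by fact
  show ?thesis
    using I_prime one_imp_carrier I_notcarr
    by unfold_locales auto
qed


section \<open>Prime spectrum, minimal primes and height\<close>

definition zariski_topology :: "('a, 'b) ring_scheme \<Rightarrow> 'a set topology" where
  "zariski_topology R =
     topology (\<lambda>U. \<exists>A \<subseteq> carrier R. U = {P. primeideal P R \<and> \<not> A \<subseteq> P})"

lemma openin_zariski_topology:
  "openin (zariski_topology R) U \<longleftrightarrow> (\<exists>A \<subseteq> carrier R. U = {P. primeideal P R \<and> \<not> A \<subseteq> P})"
proof -
  let ?D = "\<lambda>A. {P. primeideal P R \<and> \<not> A \<subseteq> P}"
  have "istopology (\<lambda>U. \<exists>A \<subseteq> carrier R. U = ?D A)"
    unfolding istopology_def
  proof (intro conjI allI impI)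
    fix U V
    assume "\<exists>A \<subseteq> carrier R. U = ?D A" "\<exists>A \<subseteq> carrier R. V = ?D A"
    then obtain A B where AB: "A \<subseteq> carrier R" "U = ?D A" "B \<subseteq> carrier R" "V = ?D B" by blast
    let ?C = "{a \<otimes>\<^bsub>R\<^esub> b | a b. a \<in> A \<and> b \<in> B}"
    have "?C \<subseteq> P \<longleftrightarrow> A \<subseteq> P \<or> B \<subseteq> P" if "primeideal P R" for P
    proof -
      interpret primeideal P R by fact
      show ?thesis
      proof
        assume C: "?C \<subseteq> P"
        show "A \<subseteq> P \<or> B \<subseteq> P"
        proof (rule ccontr)
          assume "\<not> (A \<subseteq> P \<or> B \<subseteq> P)"
          then obtain a b where "a \<in> A" "a \<notin> P" "b \<in> B" "b \<notin> P" by blast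
          moreover from this have "a \<otimes>\<^bsub>R\<^esub> b \<in> P" using C by blast
          ultimately show False using I_prime AB by blast
        qed
      next
        assume "A \<subseteq> P \<or> B \<subseteq> P"
        then show "?C \<subseteq> P" using AB I_l_closed I_r_closed by blast
      qed
    qed
    then have "U \<inter> V = ?D ?C" using AB by blast
    moreover have "?C \<subseteq> carrier R" if "primeideal P R" for P
    proof -
      interpret primeideal P R by fact
      show ?thesis using AB by blast
    qed
    ultimately show "\<exists>A \<subseteq> carrier R. U \<inter> V = ?D A"
    proof (cases "\<exists>P. primeideal P R")
      case False
      then have "U \<inter> V = ?D {}" using AB by blast
      then show ?thesis by blast
    qed blast
  next
    fix K
    assume "\<forall>U\<in>K. \<exists>A \<subseteq> carrier R. U = ?D A"
    then obtain f where f: "\<And>U. U \<in> K \<Longrightarrow> f U \<subseteq> carrier R \<and> U = ?D (f U)" by metis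
    have "\<Union>K = ?D (\<Union>(f ` K))"
    proof (intro equalityI subsetI)
      fix P assume "P \<in> \<Union>K"
      then obtain U where "U \<in> K" "P \<in> U" by blast
      with f[of U] show "P \<in> ?D (\<Union>(f ` K))" by auto
    next
      fix P assume "P \<in> ?D (\<Union>(f ` K))"
      then obtain U where "U \<in> K" "P \<in> ?D (f U)" by blast
      with f[of U] show "P \<in> \<Union>K" by blast
    qed
    moreover have "\<Union>(f ` K) \<subseteq> carrier R" using f by blast
    ultimately show "\<exists>A \<subseteq> carrier R. \<Union>K = ?D A" by blast
  qed
  then show ?thesis
    by (simp add: zariski_topology_def topology_inverse')
qed

lemma topspace_zariski_topology: "topspace (zariski_topology R) = {P. primeideal P R}"
proof
  show "topspace (zariski_topology R) \<subseteq> {P. primeideal P R}"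
    by (auto simp: topspace_def openin_zariski_topology)
  have "\<not> carrier R \<subseteq> P" if "primeideal P R" for P
    using primeideal.I_notcarr[OF that] ideal.Icarr[OF primeideal.axioms(1)[OF that]] by blast
  then have "openin (zariski_topology R) {P. primeideal P R}"
    by (auto simp: openin_zariski_topology intro!: exI[of _ "carrier R"])
  then show "{P. primeideal P R} \<subseteq> topspace (zariski_topology R)"
    by (rule openin_subset)
qed

definition minimal_primes :: "('a, 'b) ring_scheme \<Rightarrow> 'a set set" where
  "minimal_primes R = {P. primeideal P R \<and> (\<forall>Q. primeideal Q R \<and> Q \<subseteq> P \<longrightarrow> Q = P)}"

definition height :: "('a, 'b) ring_scheme \<Rightarrow> 'a set \<Rightarrow> enat" where
  "height R P =
     Sup {enat n | n. \<exists>C. (\<forall>i\<le>n. primeideal (C i) R) \<and> (\<forall>i<n. C i \<subset> C (Suc i)) \<and> C n = P}"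


section \<open>q-ideals and the q-Krull dimension\<close>

definition annihilator :: "('a, 'b) ring_scheme \<Rightarrow> 'a set \<Rightarrow> 'a set" where
  "annihilator R I = {x \<in> carrier R. \<forall>a\<in>I. x \<otimes>\<^bsub>R\<^esub> a = \<zero>\<^bsub>R\<^esub>}"

definition dense_ideal :: "('a, 'b) ring_scheme \<Rightarrow> 'a set \<Rightarrow> bool" where
  "dense_ideal R I \<longleftrightarrow> ideal I R \<and> annihilator R I = {\<zero>\<^bsub>R\<^esub>}"

definition fg_ideal :: "('a, 'b) ring_scheme \<Rightarrow> 'a set \<Rightarrow> bool" where
  "fg_ideal R I \<longleftrightarrow> (\<exists>A \<subseteq> carrier R. finite A \<and> I = Idl\<^bsub>R\<^esub> A)"

definition semiregular_ideal :: "('a, 'b) ring_scheme \<Rightarrow> 'a set \<Rightarrow> bool" where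
  "semiregular_ideal R I \<longleftrightarrow>
     ideal I R \<and> (\<exists>J. fg_ideal R J \<and> dense_ideal R J \<and> J \<subseteq> I)"

definition fg_semiregular_ideals :: "('a, 'b) ring_scheme \<Rightarrow> 'a set set" where
  "fg_semiregular_ideals R = {J. fg_ideal R J \<and> semiregular_ideal R J}"

text \<open>
  \<open>q_envelope R E \<iota> I\<close> is the submodule \<open>I\<^sub>q\<close> of an \<open>R\<close>-module \<open>E\<close> into which \<open>R\<close> embeds by \<open>\<iota>\<close>;
  in the literature \<open>E\<close> is the injective envelope of \<open>R\<close>.  The notion of a q-ideal only involves
  the intersection of \<open>I\<^sub>q\<close> with \<open>R\<close>.  This is \<open>q_trace R I\<close>, the part of the definition of \<open>I\<^sub>q\<close>
  that concerns elements of \<open>R\<close>, and it is the same for every \<open>E\<close> by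
  \<open>q_envelope_inter_ring\<close>, so no injective envelope has to be chosen.
\<close>

definition q_envelope ::
  "('a, 'b) ring_scheme \<Rightarrow> ('a, 'e, 'c) module_scheme \<Rightarrow> ('a \<Rightarrow> 'e) \<Rightarrow> 'a set \<Rightarrow> 'e set" where
  "q_envelope R E \<iota> I =
     {x \<in> carrier E. \<exists>J\<in>fg_semiregular_ideals R. \<forall>j\<in>J. j \<odot>\<^bsub>E\<^esub> x \<in> \<iota> ` I}"

definition q_trace :: "('a, 'b) ring_scheme \<Rightarrow> 'a set \<Rightarrow> 'a set" where
  "q_trace R I = {x \<in> carrier R. \<exists>J\<in>fg_semiregular_ideals R. \<forall>j\<in>J. j \<otimes>\<^bsub>R\<^esub> x \<in> I}"

lemma q_envelope_inter_ring:
  assumes "Module.module R E" and "ideal I R"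
    and "\<iota> \<in> carrier R \<rightarrow> carrier E" and "inj_on \<iota> (carrier R)"
    and lin: "\<And>r x. \<lbrakk>r \<in> carrier R; x \<in> carrier R\<rbrakk> \<Longrightarrow> \<iota> (r \<otimes>\<^bsub>R\<^esub> x) = r \<odot>\<^bsub>E\<^esub> \<iota> x"
  shows "q_envelope R E \<iota> I \<inter> \<iota> ` carrier R = \<iota> ` q_trace R I"
proof -
  interpret Module.module R E by fact
  have I: "I \<subseteq> carrier R"
    using ideal.Icarr[OF assms(2)] by blast
  have *: "j \<odot>\<^bsub>E\<^esub> \<iota> x \<in> \<iota> ` I \<longleftrightarrow> j \<otimes>\<^bsub>R\<^esub> x \<in> I"
    if "J \<in> fg_semiregular_ideals R" "j \<in> J" "x \<in> carrier R" for J j x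
  proof -
    have "ideal J R"
      using that by (simp add: fg_semiregular_ideals_def semiregular_ideal_def)
    then have j: "j \<in> carrier R"
      using ideal.Icarr that(2) by metis
    then have "j \<odot>\<^bsub>E\<^esub> \<iota> x \<in> \<iota> ` I \<longleftrightarrow> \<iota> (j \<otimes>\<^bsub>R\<^esub> x) \<in> \<iota> ` I"
      using lin that(3) by simp
    also have "\<dots> \<longleftrightarrow> j \<otimes>\<^bsub>R\<^esub> x \<in> I"
      using inj_on_image_mem_iff[OF assms(4) _ I] j that(3) by simp
    finally show ?thesis .
  qed
  then have "\<iota> x \<in> q_envelope R E \<iota> I \<longleftrightarrow> x \<in> q_trace R I" if "x \<in> carrier R" for x
    using that assms(3) * by (auto simp: q_envelope_def q_trace_def Pi_iff simp del: image_iff cong: bex_cong ball_cong)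
  moreover have "q_trace R I \<subseteq> carrier R"
    by (auto simp: q_trace_def)
  ultimately show ?thesis
    by blast
qed

definition q_ideal :: "('a, 'b) ring_scheme \<Rightarrow> 'a set \<Rightarrow> bool" where
  "q_ideal R I \<longleftrightarrow> ideal I R \<and> q_trace R I = I"

definition q_Max :: "('a, 'b) ring_scheme \<Rightarrow> 'a set set" where
  "q_Max R =
     {M. q_ideal R M \<and> M \<noteq> carrier R \<and>
         (\<forall>I. q_ideal R I \<and> I \<noteq> carrier R \<and> M \<subseteq> I \<longrightarrow> I = M)}"

text \<open>For the zero ring \<open>q_Max R\<close> is empty and the supremum is \<open>0\<close>.\<close>

definition q_dim :: "('a, 'b) ring_scheme \<Rightarrow> enat" where
  "q_dim R = (SUP P\<in>q_Max R. height R P)"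

definition tau_q_von_neumann_regular :: "('a, 'b) ring_scheme \<Rightarrow> bool" where
  "tau_q_von_neumann_regular S \<longleftrightarrow>
     cring S \<and> (\<forall>M\<in>q_Max S. von_neumann_regular (localization_at S M))"

end

theory Submission
  imports Defs
begin

text \<open>
  An ideal is semi-regular iff it contains a finite set with zero annihilator; such sets are closed
  under products, so Krull's argument extends every non-semi-regular ideal to a maximal
  q-ideal, which is prime. If the q-dimension is 0, that prime is minimal. In a minimal prime
  each element is killed, up to a power, by an element outside the prime, so no minimal prime
  contains a finite dense set. Hence a family of elements is contained in no minimal prime iff it
  generates a semi-regular ideal, and this is witnessed by finitely many of its members, which is
  the compactness of the minimal spectrum. Finite dense sets of the ring remain dense modulo the
  nilradical, so a maximal q-ideal of the reduced quotient pulls back to a minimal prime, and the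
  localization there is a field.
\<close>

section \<open>Directed unions and ideal quotients\<close>

text \<open>This finiteness principle serves twice: unions of chains still avoid finite sets in
  Zorn's lemma, and a finite dense set inside a directed union of ideals already lies in one of
  them.\<close>

lemma finite_subset_directed_Union:
  assumes "K \<noteq> {}" and dir: "\<And>I J. \<lbrakk>I \<in> K; J \<in> K\<rbrakk> \<Longrightarrow> \<exists>L\<in>K. I \<union> J \<subseteq> L"
    and "finite B" "B \<subseteq> \<Union>K"
  obtains L where "L \<in> K" "B \<subseteq> L"
proof -
  from assms(3,4) have "\<exists>L\<in>K. B \<subseteq> L"
  proof (induction B rule: finite_induct)
    case empty
    then show ?case using assms(1) by blast
  next
    case (insert b B)
    then obtain L I where "L \<in> K" "B \<subseteq> L" "I \<in> K" "b \<in> I" by blast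
    then show ?case using dir[of L I] by blast
  qed
  then show thesis using that by blast
qed

lemma (in ring) ideal_directed_Union:
  assumes "K \<noteq> {}" and id: "\<And>I. I \<in> K \<Longrightarrow> ideal I R"
    and dir: "\<And>I J. \<lbrakk>I \<in> K; J \<in> K\<rbrakk> \<Longrightarrow> \<exists>L\<in>K. I \<union> J \<subseteq> L"
  shows "ideal (\<Union>K) R"
proof (rule idealI[OF ring_axioms])
  show "subgroup (\<Union>K) (add_monoid R)"
  proof (rule add.subgroupI)
    show "\<Union>K \<subseteq> carrier R" using ideal.Icarr[OF id] by blast
    show "\<Union>K \<noteq> {}"
      using assms(1) id additive_subgroup.zero_closed[OF ideal.axioms(1)] by blast
    fix a b assume "a \<in> \<Union>K" "b \<in> \<Union>K"
    then obtain I J where "I \<in> K" "a \<in> I" "J \<in> K" "b \<in> J" by auto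
    then obtain L where L: "L \<in> K" "a \<in> L" "b \<in> L" using dir[of I J] by auto
    interpret L: ideal L R using L(1) by (rule id)
    show "\<ominus> a \<in> \<Union>K" "a \<oplus> b \<in> \<Union>K"
      using L L.a_inv_closed L.a_closed by auto
  qed
  fix a x assume "a \<in> \<Union>K" and x: "x \<in> carrier R"
  then obtain I where I: "I \<in> K" "a \<in> I" by auto
  interpret I: ideal I R using I(1) by (rule id)
  show "x \<otimes> a \<in> \<Union>K" "a \<otimes> x \<in> \<Union>K"
    using I(1) I.I_l_closed[OF I(2) x] I.I_r_closed[OF I(2) x] by auto
qed

text \<open>The quotient of \<open>I\<close> by \<open>X\<close> enlarges a maximal ideal in Krull's
  argument; for \<open>I\<close> zero and \<open>X\<close> a singleton it is the annihilator of an
  element.\<close>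

lemma (in cring) ideal_colon:
  assumes "ideal I R" "X \<subseteq> carrier R"
  shows "ideal {y \<in> carrier R. \<forall>x\<in>X. x \<otimes> y \<in> I} R"
proof -
  interpret I: ideal I R by fact
  have X: "x \<in> carrier R" if "x \<in> X" for x using that assms(2) by blast
  show ?thesis
  proof (rule idealI[OF ring_axioms])
    show "subgroup {y \<in> carrier R. \<forall>x\<in>X. x \<otimes> y \<in> I} (add_monoid R)"
      by (rule add.subgroupI) (use X in \<open>auto simp: r_distr r_minus intro!: exI[of _ \<zero>]\<close>)
    fix a x
    assume a: "a \<in> {y \<in> carrier R. \<forall>x\<in>X. x \<otimes> y \<in> I}" and x: "x \<in> carrier R"
    have "z \<otimes> (x \<otimes> a) = x \<otimes> (z \<otimes> a)" "x \<otimes> a = a \<otimes> x" if "z \<in> X" for z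
      using a x X[OF that] by (auto simp: m_ac)
    then show "x \<otimes> a \<in> {y \<in> carrier R. \<forall>x\<in>X. x \<otimes> y \<in> I}"
      "a \<otimes> x \<in> {y \<in> carrier R. \<forall>x\<in>X. x \<otimes> y \<in> I}"
      using a x by (auto simp: I.I_l_closed)
  qed
qed


section \<open>Prime ideals avoiding a family of finite sets\<close>

text \<open>
  Used with the finite dense sets, to obtain the maximal q-ideals, and with the singletons from a
  multiplicative set.
\<close>

lemma (in cring) exists_prime_avoiding:
  assumes "F \<noteq> {}" and fin: "\<And>A. A \<in> F \<Longrightarrow> finite A \<and> A \<subseteq> carrier R"
    and prod: "\<And>A B. \<lbrakk>A \<in> F; B \<in> F\<rbrakk> \<Longrightarrow> {a \<otimes> b | a b. a \<in> A \<and> b \<in> B} \<in> F"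
    and I: "ideal I R" and avoid: "\<And>A. A \<in> F \<Longrightarrow> \<not> A \<subseteq> I"
  obtains P where "primeideal P R" "I \<subseteq> P" "\<And>A. A \<in> F \<Longrightarrow> \<not> A \<subseteq> P"
    "\<And>J. \<lbrakk>ideal J R; P \<subseteq> J; \<And>A. A \<in> F \<Longrightarrow> \<not> A \<subseteq> J\<rbrakk> \<Longrightarrow> J = P"
proof -
  let ?\<A> = "{J. ideal J R \<and> I \<subseteq> J \<and> (\<forall>A\<in>F. \<not> A \<subseteq> J)}"
  have "\<exists>P\<in>?\<A>. \<forall>J\<in>?\<A>. P \<subseteq> J \<longrightarrow> J = P"
  proof (rule subset_Zorn_nonempty)
    show "?\<A> \<noteq> {}" using I avoid by blast
    fix C assume C: "C \<noteq> {}" "subset.chain ?\<A> C"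
    then have sub: "C \<subseteq> ?\<A>" by (simp add: subset_chain_def)
    have chain: "I \<subseteq> J \<or> J \<subseteq> I" if "I \<in> C" "J \<in> C" for I J
      using C(2) that by (simp add: subset_chain_def)
    have dir: "\<exists>L\<in>C. I \<union> J \<subseteq> L" if "I \<in> C" "J \<in> C" for I J
      using chain[OF that] that by (metis Un_absorb1 Un_absorb2 subset_refl)
    have "ideal (\<Union>C) R"
      using C(1) _ dir by (rule ideal_directed_Union) (use sub in blast)
    \<comment> \<open>Members of \<open>F\<close> are finite, so one contained in the union of the
      chain would lie in a single ideal of the chain.\<close>
    moreover have "\<not> A \<subseteq> \<Union>C" if A: "A \<in> F" for A
    proof
      assume "A \<subseteq> \<Union>C"
      then obtain L where "L \<in> C" "A \<subseteq> L"
        using finite_subset_directed_Union[OF C(1) dir, of A] fin[OF A] by blast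
      then show False using sub A by blast
    qed
    ultimately show "\<Union>C \<in> ?\<A>" using C(1) sub by blast
  qed
  then obtain P where P\<A>: "P \<in> ?\<A>" and max\<A>: "\<forall>J\<in>?\<A>. P \<subseteq> J \<longrightarrow> J = P" by (rule bexE)
  then have P: "ideal P R" "I \<subseteq> P" "\<And>A. A \<in> F \<Longrightarrow> \<not> A \<subseteq> P" by auto
  have max: "J = P" if "ideal J R" "P \<subseteq> J" "\<And>A. A \<in> F \<Longrightarrow> \<not> A \<subseteq> J" for J
    using max\<A> P(2) that by blast
  interpret P: ideal P R by fact
  have "primeideal P R"
  proof (rule primeidealI[OF P(1) is_cring])
    show "carrier R \<noteq> P" using assms(1) fin P(3) by blast
    fix a b assume ab: "a \<in> carrier R" "b \<in> carrier R" "a \<otimes> b \<in> P"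
    show "a \<in> P \<or> b \<in> P"
    proof (rule ccontr)
      assume neg: "\<not> (a \<in> P \<or> b \<in> P)"
      \<comment> \<open>The quotient of \<open>P\<close> by \<open>b\<close> contains
        \<open>P\<close> and \<open>a\<close>, so it is strictly larger than \<open>P\<close>, and
        maximality forces it to contain some \<open>A\<close> in \<open>F\<close>.\<close>
      let ?J = "{y \<in> carrier R. \<forall>x\<in>{b}. x \<otimes> y \<in> P}"
      have "ideal ?J R" using ab P(1) by (intro ideal_colon) auto
      moreover have "P \<subseteq> ?J" using ab P.Icarr P.I_l_closed by auto
      moreover have "a \<in> ?J" using ab m_comm by auto
      ultimately obtain A where A: "A \<in> F" "A \<subseteq> ?J" using max[of ?J] neg by blast
      \<comment> \<open>Since \<open>A\<close> times \<open>b\<close> lies in \<open>P\<close>, the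
        quotient of \<open>P\<close> by \<open>A\<close> contains \<open>b\<close>, so it contains
        some \<open>B\<close> in \<open>F\<close>. Then the product set of \<open>A\<close> and
        \<open>B\<close> lies in \<open>P\<close>, which is excluded.\<close>
      let ?K = "{y \<in> carrier R. \<forall>x\<in>A. x \<otimes> y \<in> P}"
      have "ideal ?K R" using fin[OF A(1)] P(1) by (intro ideal_colon) auto
      moreover have "P \<subseteq> ?K" using fin[OF A(1)] P.Icarr P.I_l_closed by auto
      moreover have "b \<in> ?K" using ab A fin[OF A(1)] m_comm by auto
      ultimately obtain B where B: "B \<in> F" "B \<subseteq> ?K" using max[of ?K] neg by blast
      then have "{a \<otimes> b | a b. a \<in> A \<and> b \<in> B} \<subseteq> P" by blast
      then show False using P(3) prod[OF A(1) B(1)] by blast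
    qed
  qed
  then show thesis using that P max by blast
qed

text \<open>Avoiding a singleton means omitting its element, and the product set of two singletons
  is a singleton, so the zero ideal can be extended while avoiding all singletons from
  \<open>S\<close>.\<close>

lemma (in cring) exists_prime_disjoint:
  assumes "S \<subseteq> carrier R" "S \<noteq> {}" and "\<And>s t. \<lbrakk>s \<in> S; t \<in> S\<rbrakk> \<Longrightarrow> s \<otimes> t \<in> S"
    and "\<zero> \<notin> S"
  obtains P where "primeideal P R" "P \<inter> S = {}"
proof (rule exists_prime_avoiding[of "(\<lambda>s. {s}) ` S" "{\<zero>}"])
  show "ideal {\<zero>} R" by (rule zeroideal)
next
  fix P assume "primeideal P R" "\<And>A. A \<in> (\<lambda>s. {s}) ` S \<Longrightarrow> \<not> A \<subseteq> P"
  then show thesis using that[of P] by blast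
qed (use assms in auto)

section \<open>The nilradical as the intersection of all primes\<close>

lemma (in cring) nilradical_eq_Inter_primes:
  "nilradical R = {x \<in> carrier R. \<forall>P. primeideal P R \<longrightarrow> x \<in> P}"
proof (intro equalityI subsetI CollectI conjI allI impI)
  fix x assume "x \<in> nilradical R"
  then obtain n :: nat where x: "x \<in> carrier R" "x [^] n = \<zero>" by (auto simp: nilradical_def)
  then show "x \<in> carrier R" by blast
  fix P assume "primeideal P R"
  then interpret P: primeideal P R .
  have "x \<in> P" if "x [^] m \<in> P" for m :: nat
    using that
  proof (induction m)
    case 0
    then show ?case using P.one_imp_carrier x(1) by auto
  next
    case (Suc m)
    then show ?case using P.I_prime[of "x [^] m" x] x(1) by auto
  qed
  then show "x \<in> P" using x(2) P.zero_closed by metis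
next
  fix x assume x: "x \<in> {x \<in> carrier R. \<forall>P. primeideal P R \<longrightarrow> x \<in> P}"
  show "x \<in> nilradical R"
  proof (rule ccontr)
    assume nil: "x \<notin> nilradical R"
    \<comment> \<open>Since \<open>x\<close> is not nilpotent, its powers form a multiplicative set
      without zero. A prime disjoint from it omits the first power, \<open>x\<close> itself.\<close>
    let ?S = "range (\<lambda>n::nat. x [^] n)"
    have "s \<otimes> t \<in> ?S" if "s \<in> ?S" "t \<in> ?S" for s t
      using that x by (auto simp: nat_pow_mult)
    moreover have "\<zero> \<notin> ?S" using nil x by (auto simp: nilradical_def)
    moreover have "?S \<subseteq> carrier R" using x by auto
    ultimately obtain P where P: "primeideal P R" "P \<inter> ?S = {}"
      using exists_prime_disjoint[of ?S] by blast
    then have "x [^] (1::nat) \<notin> P" by blast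
    then show False using x P(1) by auto
  qed
qed

text \<open>The closure properties are inherited from the primes, without a binomial expansion for
  sums of nilpotents.\<close>

lemma (in cring) ideal_nilradical: "ideal (nilradical R) R"
proof (rule idealI[OF ring_axioms])
  note prime_ideal = primeideal.axioms(1)
  note prime_additive = ideal.axioms(1)[OF prime_ideal]
  show "subgroup (nilradical R) (add_monoid R)"
    unfolding nilradical_eq_Inter_primes
  proof (rule add.subgroupI)
    have "\<zero> \<in> {x \<in> carrier R. \<forall>P. primeideal P R \<longrightarrow> x \<in> P}"
      using additive_subgroup.zero_closed[OF prime_additive] by blast
    then show "{x \<in> carrier R. \<forall>P. primeideal P R \<longrightarrow> x \<in> P} \<noteq> {}" by blast
  qed (auto intro: additive_subgroup.a_closed[OF prime_additive]
      additive_subgroup.a_inv_closed[OF prime_additive])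
qed (auto simp: nilradical_eq_Inter_primes intro: ideal.I_l_closed[OF primeideal.axioms(1)]
      ideal.I_r_closed[OF primeideal.axioms(1)])


section \<open>Minimal primes\<close>

text \<open>Otherwise the multiplicative set generated by \<open>a\<close> and the complement of
  \<open>M\<close> omits zero. A prime disjoint from it lies inside \<open>M\<close>, so it equals
  \<open>M\<close> by minimality, and yet it misses \<open>a\<close>.\<close>

lemma (in cring) minimal_prime_annihilator:
  assumes "M \<in> minimal_primes R" and a: "a \<in> M"
  obtains s n where "s \<in> carrier R - M" "s \<otimes> a [^] (n::nat) = \<zero>"
proof (rule ccontr)
  assume neg: "\<not> thesis"
  have M: "primeideal M R" and min: "\<And>Q. \<lbrakk>primeideal Q R; Q \<subseteq> M\<rbrakk> \<Longrightarrow> Q = M"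
    using assms(1) by (auto simp: minimal_primes_def)
  interpret M: primeideal M R by fact
  interpret C: mult_subset R "carrier R - M" by (rule mult_subset_prime_compl[OF M])
  have acarr: "a \<in> carrier R" using a by (rule M.Icarr)
  let ?S = "{s \<otimes> a [^] n | s n. s \<in> carrier R - M \<and> n \<in> (UNIV :: nat set)}"
  have one: "\<one> \<in> carrier R - M" by (rule C.S_one)
  have "x \<otimes> y \<in> ?S" if "x \<in> ?S" "y \<in> ?S" for x y
  proof -
    from that obtain s n t m where e: "x = s \<otimes> a [^] (n::nat)" "s \<in> carrier R - M"
      "y = t \<otimes> a [^] (m::nat)" "t \<in> carrier R - M" by blast
    then have "x \<otimes> y = (s \<otimes> t) \<otimes> (a [^] n \<otimes> a [^] m)"
      using acarr by (simp add: m_ac)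
    also have "\<dots> = (s \<otimes> t) \<otimes> a [^] (n + m)" using acarr by (simp add: nat_pow_mult)
    finally show ?thesis using C.S_mult[OF e(2,4)] by blast
  qed
  moreover have "\<zero> \<notin> ?S"
  proof
    assume "\<zero> \<in> ?S"
    then obtain s n where "s \<in> carrier R - M" "s \<otimes> a [^] (n::nat) = \<zero>" by force
    then show False using neg that by blast
  qed
  moreover have "?S \<subseteq> carrier R" using acarr by auto
  ultimately obtain Q where Q: "primeideal Q R" "Q \<inter> ?S = {}"
    using exists_prime_disjoint[of ?S] one by blast
  \<comment> \<open>The exponent 0 puts the whole complement of \<open>M\<close> into the
    multiplicative set.\<close>
  have "s \<in> ?S" if "s \<in> carrier R - M" for s
    using that by (auto intro!: exI[of _ s] exI[of _ "0::nat"])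
  then have "Q \<subseteq> M"
    using Q(2) ideal.Icarr[OF primeideal.axioms(1)[OF Q(1)]] by blast
  then have "Q = M" using min Q(1) by blast
  moreover have "a \<in> ?S"
    using acarr one by (auto intro!: exI[of _ \<one>] exI[of _ "1::nat"])
  ultimately show False using Q(2) a by blast
qed

text \<open>The witnesses for the single elements can be multiplied: the product stays outside the
  prime, and each element keeps its own exponent.\<close>

lemma (in cring) minimal_prime_finite_annihilator:
  assumes M: "M \<in> minimal_primes R" and "finite A" "A \<subseteq> M"
  obtains s and n :: "'a \<Rightarrow> nat" where "s \<in> carrier R - M" "\<And>a. a \<in> A \<Longrightarrow> s \<otimes> a [^] n a = \<zero>"
proof -
  have prime: "primeideal M R" using M by (simp add: minimal_primes_def)
  interpret M: primeideal M R by fact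
  interpret C: mult_subset R "carrier R - M" by (rule mult_subset_prime_compl[OF prime])
  from assms(2,3) have "\<exists>s\<in>carrier R - M. \<forall>a\<in>A. \<exists>n::nat. s \<otimes> a [^] n = \<zero>"
  proof (induction A rule: finite_induct)
    case empty
    then show ?case using C.S_one by blast
  next
    case (insert b A)
    then obtain s where s: "s \<in> carrier R - M" "\<forall>a\<in>A. \<exists>n::nat. s \<otimes> a [^] n = \<zero>" by blast
    obtain t m where t: "t \<in> carrier R - M" "t \<otimes> b [^] (m::nat) = \<zero>"
      using minimal_prime_annihilator[OF M, of b] insert.prems by blast
    have "\<exists>n::nat. (s \<otimes> t) \<otimes> a [^] n = \<zero>" if a: "a \<in> insert b A" for a
    proof -
      have carr: "a \<in> carrier R" "s \<in> carrier R" "t \<in> carrier R"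
        using a insert.prems M.Icarr s t by blast+
      have "(s \<otimes> t) \<otimes> a [^] n = t \<otimes> (s \<otimes> a [^] n)" "(s \<otimes> t) \<otimes> a [^] n = s \<otimes> (t \<otimes> a [^] n)"
        for n :: nat
        using carr by (simp_all add: m_ac)
      then show ?thesis using a s(2) t(2) carr by (metis insertE r_null)
    qed
    then show ?case using C.S_mult s(1) t(1) by blast
  qed
  then show thesis using that by metis
qed


section \<open>Finite dense sets\<close>

text \<open>These are the finite generating sets of the finitely generated dense ideals (see
  \<open>dense_ideal_genideal_iff\<close>). Working with generators makes products and directed
  unions elementary.\<close>

definition finite_dense :: "('a, 'b) ring_scheme \<Rightarrow> 'a set \<Rightarrow> bool" where
  "finite_dense R A \<longleftrightarrow> A \<subseteq> carrier R \<and> finite A \<and>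
     (\<forall>x\<in>carrier R. (\<forall>a\<in>A. x \<otimes>\<^bsub>R\<^esub> a = \<zero>\<^bsub>R\<^esub>) \<longrightarrow> x = \<zero>\<^bsub>R\<^esub>)"

context cring
begin

lemma finite_dense_one: "finite_dense R {\<one>}"
  by (simp add: finite_dense_def)

text \<open>If \<open>x\<close> kills all products, then each \<open>x \<otimes> a\<close> is killed
  by \<open>B\<close> and vanishes, so \<open>x\<close> is killed by \<open>A\<close>. This closure
  is what Krull's argument requires.\<close>

lemma finite_dense_prod:
  assumes A: "finite_dense R A" and B: "finite_dense R B"
  shows "finite_dense R {a \<otimes> b | a b. a \<in> A \<and> b \<in> B}"
  unfolding finite_dense_def
proof (intro conjI ballI impI)
  have Ac: "a \<in> carrier R" if "a \<in> A" for a using A that by (auto simp: finite_dense_def)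
  have Bc: "b \<in> carrier R" if "b \<in> B" for b using B that by (auto simp: finite_dense_def)
  show "{a \<otimes> b | a b. a \<in> A \<and> b \<in> B} \<subseteq> carrier R" using Ac Bc by auto
  show "finite {a \<otimes> b | a b. a \<in> A \<and> b \<in> B}"
    using A B by (auto simp: finite_dense_def intro: finite_image_set2)
  fix x assume x: "x \<in> carrier R"
    and ann: "\<forall>c\<in>{a \<otimes> b | a b. a \<in> A \<and> b \<in> B}. x \<otimes> c = \<zero>"
  have "x \<otimes> a = \<zero>" if a: "a \<in> A" for a
  proof -
    have "(x \<otimes> a) \<otimes> b = \<zero>" if "b \<in> B" for b
    proof -
      have "(x \<otimes> a) \<otimes> b = x \<otimes> (a \<otimes> b)"
        using x Ac[OF a] Bc[OF that] by (rule m_assoc)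
      also have "\<dots> = \<zero>" using ann a that by blast
      finally show ?thesis .
    qed
    then show ?thesis using B x Ac[OF a] by (simp add: finite_dense_def)
  qed
  then show "x = \<zero>" using A x by (simp add: finite_dense_def)
qed

text \<open>Induction on the sum of the exponents: if \<open>s\<close> is nonzero, density gives
  \<open>a\<close> with \<open>s \<otimes> a\<close> nonzero, and this product satisfies the
  hypothesis with the exponent of \<open>a\<close> lowered by one.\<close>

lemma finite_dense_power_annihilator:
  fixes n :: "'a \<Rightarrow> nat"
  assumes A: "finite_dense R A"
  shows "\<lbrakk>s \<in> carrier R; \<And>a. a \<in> A \<Longrightarrow> s \<otimes> a [^] n a = \<zero>\<rbrakk> \<Longrightarrow> s = \<zero>"
proof (induction "sum n A" arbitrary: n s rule: less_induct)
  case less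
  show ?case
  proof (rule ccontr)
    assume "s \<noteq> \<zero>"
    then obtain a where a: "a \<in> A" "s \<otimes> a \<noteq> \<zero>"
      using A less.prems(1) by (auto simp: finite_dense_def)
    have Ac: "b \<in> carrier R" if "b \<in> A" for b using A that by (auto simp: finite_dense_def)
    \<comment> \<open>An exponent 0 at \<open>a\<close> would read \<open>s = \<zero>\<close>, so
      there is room to lower it.\<close>
    have "n a \<noteq> 0" using less.prems(1) less.prems(2)[OF a(1)] \<open>s \<noteq> \<zero>\<close> by (cases "n a") auto
    then obtain k where k: "n a = Suc k" by (cases "n a") auto
    let ?n = "n(a := k)"
    have "sum ?n A < sum n A"
      using A a(1) k by (intro sum_strict_mono_ex1) (auto simp: finite_dense_def)
    moreover have "(s \<otimes> a) \<otimes> b [^] ?n b = \<zero>" if b: "b \<in> A" for b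
    proof (cases "b = a")
      case True
      have "(s \<otimes> a) \<otimes> a [^] k = s \<otimes> a [^] n a"
        using Ac[OF a(1)] less.prems(1) k by (simp add: m_ac)
      then show ?thesis using True less.prems(2)[OF a(1)] by simp
    next
      case False
      have "(s \<otimes> a) \<otimes> b [^] n b = a \<otimes> (s \<otimes> b [^] n b)"
        using Ac[OF a(1)] Ac[OF b] less.prems(1) by (simp add: m_ac)
      then show ?thesis using False less.prems(2)[OF b] Ac[OF a(1)] by simp
    qed
    ultimately have "s \<otimes> a = \<zero>"
      using less.hyps[of ?n "s \<otimes> a"] less.prems(1) Ac[OF a(1)] by blast
    then show False using a(2) by blast
  qed
qed

text \<open>A finite subset of a minimal prime has powers with a common annihilator outside the
  prime. Density forces that annihilator to be zero, which lies in every ideal.\<close>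

lemma finite_dense_not_subset_minimal_prime:
  assumes "finite_dense R A" "M \<in> minimal_primes R"
  shows "\<not> A \<subseteq> M"
proof
  assume "A \<subseteq> M"
  moreover have "finite A" using assms(1) by (simp add: finite_dense_def)
  ultimately obtain s and n :: "'a \<Rightarrow> nat"
    where s: "s \<in> carrier R - M" "\<And>a. a \<in> A \<Longrightarrow> s \<otimes> a [^] n a = \<zero>"
    using minimal_prime_finite_annihilator[OF assms(2)] by metis
  then have "s = \<zero>" using finite_dense_power_annihilator[OF assms(1), of s n] by blast
  moreover have "ideal M R" using assms(2) by (auto simp: minimal_primes_def primeideal.axioms(1))
  ultimately show False using s(1) additive_subgroup.zero_closed[OF ideal.axioms(1)] by blast
qed

lemma dense_ideal_genideal_iff:
  assumes "A \<subseteq> carrier R" "finite A"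
  shows "dense_ideal R (Idl A) \<longleftrightarrow> finite_dense R A"
proof -
  interpret J: ideal "Idl A" R by (rule genideal_ideal[OF assms(1)])
  have "(\<forall>a\<in>Idl A. x \<otimes> a = \<zero>) \<longleftrightarrow> (\<forall>a\<in>A. x \<otimes> a = \<zero>)" if x: "x \<in> carrier R" for x
  proof
    assume "\<forall>a\<in>A. x \<otimes> a = \<zero>"
    \<comment> \<open>The annihilator of \<open>x\<close>, written as an ideal quotient of zero, is
      an ideal; containing the generators, it contains the ideal they generate.\<close>
    then have "A \<subseteq> {y \<in> carrier R. \<forall>z\<in>{x}. z \<otimes> y \<in> {\<zero>}}" using assms(1) by auto
    then have "Idl A \<subseteq> {y \<in> carrier R. \<forall>z\<in>{x}. z \<otimes> y \<in> {\<zero>}}"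
      using x by (intro genideal_minimal ideal_colon zeroideal) auto
    then show "\<forall>a\<in>Idl A. x \<otimes> a = \<zero>" by auto
  qed (use genideal_self[OF assms(1)] in blast)
  then have "annihilator R (Idl A) = {x \<in> carrier R. \<forall>a\<in>A. x \<otimes> a = \<zero>}"
    by (auto simp: annihilator_def)
  moreover have "\<zero> \<otimes> a = \<zero>" if "a \<in> A" for a using that assms(1) by auto
  ultimately show ?thesis
    using assms J.ideal_axioms by (auto simp: dense_ideal_def finite_dense_def)
qed

lemma semiregular_ideal_iff:
  assumes "ideal I R"
  shows "semiregular_ideal R I \<longleftrightarrow> (\<exists>A. finite_dense R A \<and> A \<subseteq> I)"
proof
  assume "semiregular_ideal R I"
  then obtain A where A: "A \<subseteq> carrier R" "finite A" "dense_ideal R (Idl A)" "Idl A \<subseteq> I"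
    by (auto simp: semiregular_ideal_def fg_ideal_def)
  then show "\<exists>A. finite_dense R A \<and> A \<subseteq> I"
    using dense_ideal_genideal_iff[OF A(1,2)] genideal_self[OF A(1)] by blast
next
  assume "\<exists>A. finite_dense R A \<and> A \<subseteq> I"
  then obtain A where A: "finite_dense R A" "A \<subseteq> I" by blast
  then have Ac: "A \<subseteq> carrier R" "finite A" by (auto simp: finite_dense_def)
  have "fg_ideal R (Idl A)" using Ac by (auto simp: fg_ideal_def)
  moreover have "dense_ideal R (Idl A)" using A(1) dense_ideal_genideal_iff[OF Ac] by simp
  moreover have "Idl A \<subseteq> I" using assms A(2) by (rule genideal_minimal)
  ultimately show "semiregular_ideal R I" using assms by (auto simp: semiregular_ideal_def)
qed


section \<open>Maximal q-ideals\<close>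

text \<open>A finitely generated dense ideal inside \<open>I\<close> multiplies the unit into
  \<open>I\<close>, so the unit belongs to the trace.\<close>

lemma q_ideal_semiregular_imp_eq_carrier:
  assumes "q_ideal R I" "semiregular_ideal R I"
  shows "I = carrier R"
proof -
  have I: "ideal I R" and tr: "q_trace R I = I" using assms(1) by (auto simp: q_ideal_def)
  obtain J where J: "fg_ideal R J" "dense_ideal R J" "J \<subseteq> I"
    using assms(2) by (auto simp: semiregular_ideal_def)
  then have "J \<in> fg_semiregular_ideals R"
    by (auto simp: fg_semiregular_ideals_def semiregular_ideal_def dense_ideal_def)
  moreover have "j \<otimes> \<one> \<in> I" if "j \<in> J" for j
    using that J(3) ideal.Icarr[OF I, of j] by auto
  ultimately have "\<one> \<in> q_trace R I" by (auto simp: q_trace_def)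
  then show ?thesis using tr ideal.one_imp_carrier[OF I] by simp
qed

text \<open>If a semi-regular \<open>J\<close> multiplies \<open>x\<close> into \<open>P\<close>,
  some element of \<open>J\<close> lies outside \<open>P\<close>, and primeness gives
  \<open>x\<close> in \<open>P\<close>.\<close>

lemma q_ideal_prime_not_semiregular:
  assumes "primeideal P R" "\<not> semiregular_ideal R P"
  shows "q_ideal R P"
proof -
  interpret P: primeideal P R by fact
  have "x \<in> P" if x: "x \<in> q_trace R P" for x
  proof -
    from x obtain J where J: "semiregular_ideal R J" "\<And>j. j \<in> J \<Longrightarrow> j \<otimes> x \<in> P"
      and xc: "x \<in> carrier R"
      by (auto simp: q_trace_def fg_semiregular_ideals_def)
    have "\<not> J \<subseteq> P" using J(1) assms(2) P.ideal_axioms by (auto simp: semiregular_ideal_def)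
    then obtain j where "j \<in> J" "j \<notin> P" by blast
    moreover from this have "j \<in> carrier R"
      using J(1) ideal.Icarr by (metis semiregular_ideal_def)
    ultimately show ?thesis using P.I_prime J(2) xc by blast
  qed
  moreover have "x \<in> q_trace R P" if x: "x \<in> P" for x
  proof -
    \<comment> \<open>For the other inclusion the unit ideal serves as the semi-regular
      multiplier.\<close>
    have "fg_ideal R (Idl {\<one>})" by (auto simp: fg_ideal_def intro!: exI[of _ "{\<one>}"])
    moreover have "semiregular_ideal R (Idl {\<one>})"
      using semiregular_ideal_iff[of "Idl {\<one>}"] finite_dense_one genideal_self'[of \<one>]
      by (auto simp: genideal_ideal)
    ultimately have "Idl {\<one>} \<in> fg_semiregular_ideals R" by (simp add: fg_semiregular_ideals_def)
    then show ?thesis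
      using x P.Icarr P.I_l_closed unfolding q_trace_def genideal_one by blast
  qed
  ultimately show ?thesis using P.ideal_axioms by (auto simp: q_ideal_def)
qed

text \<open>Krull's argument for finite dense sets yields a prime maximal among the non-semi-regular
  ideals. Proper q-ideals are never semi-regular, so it is also maximal among them.\<close>

lemma not_semiregular_subset_q_Max:
  assumes I: "ideal I R" and ns: "\<not> semiregular_ideal R I"
  obtains P where "P \<in> q_Max R" "primeideal P R" "I \<subseteq> P" "\<not> semiregular_ideal R P"
proof (rule exists_prime_avoiding[of "{A. finite_dense R A}" I])
  fix P
  assume P: "primeideal P R" "I \<subseteq> P" "\<And>A. A \<in> {A. finite_dense R A} \<Longrightarrow> \<not> A \<subseteq> P"
    and max: "\<And>J. \<lbrakk>ideal J R; P \<subseteq> J; \<And>A. A \<in> {A. finite_dense R A} \<Longrightarrow> \<not> A \<subseteq> J\<rbrakk> \<Longrightarrow> J = P"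
  have "ideal P R" using P(1) by (rule primeideal.axioms(1))
  then have nsP: "\<not> semiregular_ideal R P" using P(3) by (auto simp: semiregular_ideal_iff)
  have "J = P" if J: "q_ideal R J" "J \<noteq> carrier R" "P \<subseteq> J" for J
  proof (rule max)
    show iJ: "ideal J R" using J(1) by (simp add: q_ideal_def)
    have "\<not> semiregular_ideal R J" using J q_ideal_semiregular_imp_eq_carrier by blast
    then show "\<And>A. A \<in> {A. finite_dense R A} \<Longrightarrow> \<not> A \<subseteq> J"
      using iJ by (auto simp: semiregular_ideal_iff)
  qed (rule J(3))
  moreover have "P \<noteq> carrier R" using primeideal.I_notcarr[OF P(1)] by simp
  ultimately have "P \<in> q_Max R"
    using q_ideal_prime_not_semiregular[OF P(1) nsP] by (auto simp: q_Max_def)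
  then show thesis using that P nsP by blast
next
  show "{A. finite_dense R A} \<noteq> {}" using finite_dense_one by blast
  show "finite A \<and> A \<subseteq> carrier R" if "A \<in> {A. finite_dense R A}" for A
    using that by (simp add: finite_dense_def)
  show "{a \<otimes> b | a b. a \<in> A \<and> b \<in> B} \<in> {A. finite_dense R A}"
    if "A \<in> {A. finite_dense R A}" "B \<in> {A. finite_dense R A}" for A B
    using that finite_dense_prod by blast
  show "\<not> A \<subseteq> I" if "A \<in> {A. finite_dense R A}" for A
    using that ns semiregular_ideal_iff[OF I] by blast
qed (rule I)

text \<open>A maximal q-ideal is not semi-regular, so it lies in a prime maximal q-ideal, and its
  own maximality makes the two equal.\<close>

lemma q_MaxD:
  assumes "M \<in> q_Max R"
  shows "primeideal M R" "\<not> semiregular_ideal R M"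
proof -
  have M: "q_ideal R M" "M \<noteq> carrier R" using assms by (auto simp: q_Max_def)
  then show ns: "\<not> semiregular_ideal R M" using q_ideal_semiregular_imp_eq_carrier by blast
  obtain P where P: "P \<in> q_Max R" "primeideal P R" "M \<subseteq> P"
    using not_semiregular_subset_q_Max[OF _ ns] M(1) unfolding q_ideal_def by blast
  then have "P = M" using assms by (auto simp: q_Max_def)
  then show "primeideal M R" using P(2) by simp
qed

lemma q_Max_subset_minimal_primes:
  assumes "q_dim R = 0"
  shows "q_Max R \<subseteq> minimal_primes R"
proof
  fix M assume M: "M \<in> q_Max R"
  have "height R M \<le> q_dim R" unfolding q_dim_def using M by (rule SUP_upper)
  then have ht: "height R M = 0" using assms by simp
  have "Q = M" if Q: "primeideal Q R" "Q \<subseteq> M" for Q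
  proof (rule ccontr)
    assume "Q \<noteq> M"
    \<comment> \<open>A prime strictly below \<open>M\<close> would give a chain of length one
      ending at \<open>M\<close>.\<close>
    let ?C = "\<lambda>i::nat. if i = 0 then Q else M"
    have "(\<forall>i\<le>1. primeideal (?C i) R) \<and> (\<forall>i<1. ?C i \<subset> ?C (Suc i)) \<and> ?C 1 = M"
      using Q \<open>Q \<noteq> M\<close> q_MaxD(1)[OF M] by auto
    then have "enat 1 \<le> height R M"
      unfolding height_def by (intro Sup_upper CollectI exI[of _ 1] conjI exI[of _ ?C]) auto
    then show False using ht by (simp add: zero_enat_def)
  qed
  then show "M \<in> minimal_primes R" using q_MaxD(1)[OF M] by (auto simp: minimal_primes_def)
qed

section \<open>Compactness of the minimal spectrum\<close>

lemma compactin_minimal_primes: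
  assumes "q_dim R = 0"
  shows "compactin (zariski_topology R) (minimal_primes R)"
  unfolding compactin_def
proof (intro conjI allI impI)
  show "minimal_primes R \<subseteq> topspace (zariski_topology R)"
    by (auto simp: topspace_zariski_topology minimal_primes_def)
  fix \<U> assume \<U>: "(\<forall>U\<in>\<U>. openin (zariski_topology R) U) \<and> minimal_primes R \<subseteq> \<Union>\<U>"
  then obtain f where f: "\<And>U. U \<in> \<U> \<Longrightarrow> f U \<subseteq> carrier R \<and> U = {P. primeideal P R \<and> \<not> f U \<subseteq> P}"
    unfolding openin_zariski_topology by metis
  \<comment> \<open>The ideals generated by the defining sets of finitely many members of the cover
    form a directed family, so a finite dense set in their union singles out a finite
    subfamily.\<close>
  define K where "K = {Idl (\<Union>(f ` \<F>)) | \<F>. finite \<F> \<and> \<F> \<subseteq> \<U>}"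
  have sub: "\<Union>(f ` \<F>) \<subseteq> carrier R" if "\<F> \<subseteq> \<U>" for \<F> using f that by blast
  have K: "K \<noteq> {}" unfolding K_def by blast
  have idK: "ideal I R" if "I \<in> K" for I
    using that sub genideal_ideal unfolding K_def by blast
  have dir: "\<exists>L\<in>K. I \<union> J \<subseteq> L" if IJ: "I \<in> K" "J \<in> K" for I J
  proof -
    from IJ obtain \<F> \<G> where e: "I = Idl (\<Union>(f ` \<F>))" "finite \<F>" "\<F> \<subseteq> \<U>"
      "J = Idl (\<Union>(f ` \<G>))" "finite \<G>" "\<G> \<subseteq> \<U>" unfolding K_def by blast
    have "\<F> \<union> \<G> \<subseteq> \<U>" using e by blast
    note c = sub[OF this]
    have "I \<subseteq> Idl (\<Union>(f ` (\<F> \<union> \<G>)))" "J \<subseteq> Idl (\<Union>(f ` (\<F> \<union> \<G>)))"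
      unfolding e by (rule subset_Idl_subset[OF c], blast)+
    moreover have "Idl (\<Union>(f ` (\<F> \<union> \<G>))) \<in> K" unfolding K_def using e by blast
    ultimately show ?thesis by blast
  qed
  have idU: "ideal (\<Union>K) R" using K idK dir by (rule ideal_directed_Union)
  have fK: "f U \<subseteq> \<Union>K" if U: "U \<in> \<U>" for U
  proof -
    have "f U \<subseteq> Idl (\<Union>(f ` {U}))" using genideal_self[of "f U"] f[OF U] by simp
    moreover have "Idl (\<Union>(f ` {U})) \<in> K" unfolding K_def using U by blast
    ultimately show ?thesis by blast
  qed
  \<comment> \<open>Otherwise the union lies in a maximal q-ideal. This is a minimal prime, hence
    belongs to some \<open>U\<close> of the cover and cannot contain \<open>f U\<close>.\<close>
  have "semiregular_ideal R (\<Union>K)"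
  proof (rule ccontr)
    assume ns: "\<not> semiregular_ideal R (\<Union>K)"
    obtain P where P: "P \<in> q_Max R" "\<Union>K \<subseteq> P"
      by (rule not_semiregular_subset_q_Max[OF idU ns])
    then have "P \<in> \<Union>\<U>" using \<U> q_Max_subset_minimal_primes[OF assms] by (meson subsetD)
    then obtain U where U: "U \<in> \<U>" "P \<in> U" by (rule UnionE)
    then have "\<not> f U \<subseteq> P" using f[OF U(1)] by blast
    then show False using fK[OF U(1)] P(2) by (meson subset_trans)
  qed
  then obtain A where A: "finite_dense R A" "A \<subseteq> \<Union>K" using semiregular_ideal_iff[OF idU] by blast
  have "finite A" using A(1) by (simp add: finite_dense_def)
  obtain L where "L \<in> K" "A \<subseteq> L"
    by (rule finite_subset_directed_Union[OF K dir \<open>finite A\<close> A(2)])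
  then obtain \<F> where \<F>: "finite \<F>" "\<F> \<subseteq> \<U>" "A \<subseteq> Idl (\<Union>(f ` \<F>))"
    unfolding K_def by blast
  have "minimal_primes R \<subseteq> \<Union>\<F>"
  proof
    fix P assume P: "P \<in> minimal_primes R"
    then have pP: "primeideal P R" by (simp add: minimal_primes_def)
    have "\<not> \<Union>(f ` \<F>) \<subseteq> P"
      using genideal_minimal[OF primeideal.axioms(1)[OF pP]] \<F>(3)
        finite_dense_not_subset_minimal_prime[OF A(1) P] by blast
    then show "P \<in> \<Union>\<F>" using pP f \<F>(2) by blast
  qed
  then show "\<exists>\<F>. finite \<F> \<and> \<F> \<subseteq> \<U> \<and> minimal_primes R \<subseteq> \<Union>\<F>" using \<F> by blast
qed

end


section \<open>Localizations\<close>

context mult_subset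
begin

lemma loc_frac_eqI:
  assumes "a \<in> carrier R" "s \<in> S" "b \<in> carrier R" "t \<in> S" "t \<otimes> a = s \<otimes> b"
  shows "loc_frac R S a s = loc_frac R S b t"
  using assms S_one by (auto simp: loc_frac_eq_iff)

lemma loc_frac_closed: "\<lbrakk>a \<in> carrier R; s \<in> S\<rbrakk> \<Longrightarrow> loc_frac R S a s \<in> carrier (localization R S)"
  by (auto simp: carrier_localization)

lemma loc_fracE:
  assumes "X \<in> carrier (localization R S)"
  obtains a s where "X = loc_frac R S a s" "a \<in> carrier R" "s \<in> S"
  using assms by (auto simp: carrier_localization)

lemma cring_localization: "cring (localization R S)"
proof -
  let ?L = "localization R S"
  note frac_simps = loc_mult_frac loc_add_frac S_mult S_carr
  have zero: "\<zero>\<^bsub>?L\<^esub> = loc_frac R S \<zero> \<one>" and one: "\<one>\<^bsub>?L\<^esub> = loc_frac R S \<one> \<one>"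
    by (simp_all add: localization_def)
  show ?thesis
  proof (rule cringI)
    show "abelian_group ?L"
    proof (rule abelian_groupI)
      fix X Y Z assume "X \<in> carrier ?L" "Y \<in> carrier ?L" "Z \<in> carrier ?L"
      then obtain a s b t c r where e: "X = loc_frac R S a s" "Y = loc_frac R S b t"
        "Z = loc_frac R S c r" and c: "a \<in> carrier R" "b \<in> carrier R" "c \<in> carrier R"
        "s \<in> S" "t \<in> S" "r \<in> S" by (metis loc_fracE)
      then show "X \<oplus>\<^bsub>?L\<^esub> Y \<oplus>\<^bsub>?L\<^esub> Z = X \<oplus>\<^bsub>?L\<^esub> (Y \<oplus>\<^bsub>?L\<^esub> Z)"
        by (simp add: frac_simps r_distr a_assoc m_ac)
    next
      fix X Y assume "X \<in> carrier ?L" "Y \<in> carrier ?L"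
      then obtain a s b t where e: "X = loc_frac R S a s" "Y = loc_frac R S b t"
        and c: "a \<in> carrier R" "b \<in> carrier R" "s \<in> S" "t \<in> S" by (metis loc_fracE)
      then show "X \<oplus>\<^bsub>?L\<^esub> Y \<in> carrier ?L" by (simp add: frac_simps loc_frac_closed)
      show "X \<oplus>\<^bsub>?L\<^esub> Y = Y \<oplus>\<^bsub>?L\<^esub> X" using e c by (simp add: frac_simps a_comm m_comm)
    next
      fix X assume "X \<in> carrier ?L"
      then obtain a s where e: "X = loc_frac R S a s" and c: "a \<in> carrier R" "s \<in> S"
        by (metis loc_fracE)
      then show "\<zero>\<^bsub>?L\<^esub> \<oplus>\<^bsub>?L\<^esub> X = X" by (simp add: zero frac_simps S_one)
      \<comment> \<open>The sum comes out over the denominator \<open>s \<otimes> s\<close>, so it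
        still has to be identified with zero over one.\<close>
      have "loc_frac R S (\<ominus> a) s \<oplus>\<^bsub>?L\<^esub> X = loc_frac R S \<zero> (s \<otimes> s)"
        using e c by (simp add: frac_simps r_minus l_neg)
      also have "\<dots> = \<zero>\<^bsub>?L\<^esub>"
        unfolding zero using c by (intro loc_frac_eqI) (simp_all add: frac_simps S_one)
      finally have "loc_frac R S (\<ominus> a) s \<oplus>\<^bsub>?L\<^esub> X = \<zero>\<^bsub>?L\<^esub>" .
      then show "\<exists>Y\<in>carrier ?L. Y \<oplus>\<^bsub>?L\<^esub> X = \<zero>\<^bsub>?L\<^esub>"
        using c loc_frac_closed by blast
    qed (simp add: zero loc_frac_closed S_one)
    show "comm_monoid ?L"
    proof (rule comm_monoidI)
      fix X Y Z assume "X \<in> carrier ?L" "Y \<in> carrier ?L" "Z \<in> carrier ?L"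
      then obtain a s b t c r where e: "X = loc_frac R S a s" "Y = loc_frac R S b t"
        "Z = loc_frac R S c r" and c: "a \<in> carrier R" "b \<in> carrier R" "c \<in> carrier R"
        "s \<in> S" "t \<in> S" "r \<in> S" by (metis loc_fracE)
      then show "X \<otimes>\<^bsub>?L\<^esub> Y \<otimes>\<^bsub>?L\<^esub> Z = X \<otimes>\<^bsub>?L\<^esub> (Y \<otimes>\<^bsub>?L\<^esub> Z)"
        by (simp add: frac_simps m_assoc)
    next
      fix X Y assume "X \<in> carrier ?L" "Y \<in> carrier ?L"
      then obtain a s b t where e: "X = loc_frac R S a s" "Y = loc_frac R S b t"
        and c: "a \<in> carrier R" "b \<in> carrier R" "s \<in> S" "t \<in> S" by (metis loc_fracE)
      then show "X \<otimes>\<^bsub>?L\<^esub> Y \<in> carrier ?L" by (simp add: frac_simps loc_frac_closed)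
      show "X \<otimes>\<^bsub>?L\<^esub> Y = Y \<otimes>\<^bsub>?L\<^esub> X" using e c by (simp add: frac_simps m_comm)
    next
      fix X assume "X \<in> carrier ?L"
      then obtain a s where e: "X = loc_frac R S a s" and c: "a \<in> carrier R" "s \<in> S"
        by (metis loc_fracE)
      then show "\<one>\<^bsub>?L\<^esub> \<otimes>\<^bsub>?L\<^esub> X = X" by (simp add: one frac_simps S_one)
    qed (simp add: one loc_frac_closed S_one)
    fix X Y Z assume "X \<in> carrier ?L" "Y \<in> carrier ?L" "Z \<in> carrier ?L"
    then obtain a s b t c r where e: "X = loc_frac R S a s" "Y = loc_frac R S b t"
      "Z = loc_frac R S c r" and c: "a \<in> carrier R" "b \<in> carrier R" "c \<in> carrier R"
      "s \<in> S" "t \<in> S" "r \<in> S" by (metis loc_fracE)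
    \<comment> \<open>Expanding the right-hand side of distributivity produces an extra factor
      \<open>r\<close> in numerator and denominator, which is cancelled here.\<close>
    have "loc_frac R S ((t \<otimes> a \<oplus> s \<otimes> b) \<otimes> c) ((s \<otimes> t) \<otimes> r)
        = loc_frac R S ((t \<otimes> r) \<otimes> (a \<otimes> c) \<oplus> (s \<otimes> r) \<otimes> (b \<otimes> c)) ((s \<otimes> r) \<otimes> (t \<otimes> r))"
      using c by (intro loc_frac_eqI) (simp_all add: S_mult S_carr r_distr l_distr m_ac)
    then show "(X \<oplus>\<^bsub>?L\<^esub> Y) \<otimes>\<^bsub>?L\<^esub> Z = X \<otimes>\<^bsub>?L\<^esub> Z \<oplus>\<^bsub>?L\<^esub> Y \<otimes>\<^bsub>?L\<^esub> Z"
      using e c by (simp add: frac_simps)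
  qed
qed

end

text \<open>Fractions with numerator in \<open>M\<close> vanish by the annihilator hypothesis, and
  the others are inverted by exchanging numerator and denominator, so the localization is a
  field.\<close>

lemma von_neumann_regular_localization_at:
  assumes "cring R" and M: "primeideal M R"
    and ann: "\<And>a. a \<in> M \<Longrightarrow> \<exists>t\<in>carrier R - M. t \<otimes>\<^bsub>R\<^esub> a = \<zero>\<^bsub>R\<^esub>"
  shows "von_neumann_regular (localization_at R M)"
proof -
  interpret R: cring R by fact
  interpret mult_subset R "carrier R - M" by (rule mult_subset_prime_compl[OF M])
  let ?S = "carrier R - M"
  let ?L = "localization R ?S"
  have "\<exists>Y\<in>carrier ?L. X \<otimes>\<^bsub>?L\<^esub> Y \<otimes>\<^bsub>?L\<^esub> X = X" if "X \<in> carrier ?L" for X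
  proof -
    from that obtain a s where e: "X = loc_frac R ?S a s" and a: "a \<in> carrier R" and s: "s \<in> ?S"
      by (rule loc_fracE)
    show ?thesis
    proof (cases "a \<in> M")
      case True
      then obtain t where t: "t \<in> ?S" "t \<otimes>\<^bsub>R\<^esub> a = \<zero>\<^bsub>R\<^esub>" using ann by blast
      have "t \<otimes>\<^bsub>R\<^esub> (\<one>\<^bsub>R\<^esub> \<otimes>\<^bsub>R\<^esub> a) = t \<otimes>\<^bsub>R\<^esub> (s \<otimes>\<^bsub>R\<^esub> \<zero>\<^bsub>R\<^esub>)"
        using t s a by simp
      then have "X = loc_frac R ?S \<zero>\<^bsub>R\<^esub> \<one>\<^bsub>R\<^esub>"
        unfolding e using loc_frac_eq_iff[OF a s R.zero_closed S_one] t(1) by blast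
      then have "X = \<zero>\<^bsub>?L\<^esub>" by (simp add: localization_def)
      then show ?thesis
        using cring.cring_simprules[OF cring_localization] by metis
    next
      case False
      then have aS: "a \<in> ?S" using a by blast
      have "X \<otimes>\<^bsub>?L\<^esub> loc_frac R ?S s a \<otimes>\<^bsub>?L\<^esub> X
          = loc_frac R ?S (a \<otimes>\<^bsub>R\<^esub> s \<otimes>\<^bsub>R\<^esub> a) (s \<otimes>\<^bsub>R\<^esub> a \<otimes>\<^bsub>R\<^esub> s)"
        unfolding e using a s aS S_mult by (simp add: loc_mult_frac)
      also have "\<dots> = X"
        unfolding e using a s aS S_mult by (intro loc_frac_eqI) (auto simp: R.m_ac)
      finally show ?thesis using loc_frac_closed[OF _ aS] s by blast
    qed
  qed
  then show ?thesis
    using cring_localization by (auto simp: von_neumann_regular_def localization_at_def)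
qed


section \<open>The quotient by the nilradical\<close>

lemma (in ideal) rcos_eq_zero_iff:
  assumes "x \<in> carrier R"
  shows "I +> x = \<zero>\<^bsub>R Quot I\<^esub> \<longleftrightarrow> x \<in> I"
proof -
  have "\<zero>\<^bsub>R Quot I\<^esub> = I" by (simp add: FactRing_def)
  then show ?thesis using a_rcos_const[of x] a_rcos_self[OF assms] by metis
qed

lemma (in ideal) FactRing_carrier_rcos:
  assumes "X \<in> carrier (R Quot I)"
  shows "\<exists>x\<in>carrier R. X = I +> x"
  using assms by (auto simp: FactRing_def A_RCOSETS_def')

text \<open>If all \<open>x \<otimes> a\<close> are nilpotent, a high power of \<open>x\<close>
  kills a power of every \<open>a\<close> in \<open>A\<close>. Density makes that power of
  \<open>x\<close> zero, so \<open>x\<close> vanishes in the quotient.\<close>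

lemma (in cring) finite_dense_mod_nilradical:
  assumes A: "finite_dense R A"
  shows "finite_dense (R Quot nilradical R) ((+>) (nilradical R) ` A)"
proof -
  let ?N = "nilradical R"
  interpret N: ideal ?N R by (rule ideal_nilradical)
  interpret h: ring_hom_ring R "R Quot ?N" "(+>) ?N" by (rule N.rcos_ring_hom_ring)
  have fin: "finite A" and Ac: "\<And>a. a \<in> A \<Longrightarrow> a \<in> carrier R"
    using A by (auto simp: finite_dense_def)
  have "x \<in> ?N" if x: "x \<in> carrier R" and nil: "\<And>a. a \<in> A \<Longrightarrow> x \<otimes> a \<in> ?N" for x
  proof -
    have "\<exists>n::nat. (x \<otimes> a) [^] n = \<zero>" if "a \<in> A" for a
      using nil[OF that] unfolding nilradical_def by (rule CollectE) blast
    then obtain n :: "'a \<Rightarrow> nat" where n: "\<And>a. a \<in> A \<Longrightarrow> (x \<otimes> a) [^] n a = \<zero>" by metis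
    \<comment> \<open>The sum of the exponents is a common exponent for \<open>x\<close>, as it
      bounds each \<open>n a\<close>.\<close>
    have "x [^] sum n A \<otimes> a [^] n a = \<zero>" if a: "a \<in> A" for a
    proof -
      have "sum n A = (sum n A - n a) + n a" using member_le_sum[OF a, of n] fin by simp
      then have "x [^] sum n A = x [^] (sum n A - n a) \<otimes> x [^] n a"
        using nat_pow_mult[OF x] by metis
      then have "x [^] sum n A \<otimes> a [^] n a = x [^] (sum n A - n a) \<otimes> (x \<otimes> a) [^] n a"
        using x Ac[OF a] by (simp add: nat_pow_distrib m_assoc)
      then show ?thesis using n[OF a] x by simp
    qed
    then have "x [^] sum n A = \<zero>"
      using finite_dense_power_annihilator[OF A, of "x [^] sum n A" n] x by blast
    then show ?thesis using x unfolding nilradical_def by blast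
  qed
  then have "x \<in> ?N"
    if "x \<in> carrier R" "\<And>a. a \<in> A \<Longrightarrow> (?N +> x) \<otimes>\<^bsub>R Quot ?N\<^esub> (?N +> a) = \<zero>\<^bsub>R Quot ?N\<^esub>" for x
    using that Ac N.rcos_eq_zero_iff by (metis h.hom_mult m_closed)
  then have dense: "X = \<zero>\<^bsub>R Quot ?N\<^esub>"
    if "X \<in> carrier (R Quot ?N)"
      "\<And>a. a \<in> A \<Longrightarrow> X \<otimes>\<^bsub>R Quot ?N\<^esub> (?N +> a) = \<zero>\<^bsub>R Quot ?N\<^esub>" for X
    using that N.FactRing_carrier_rcos N.rcos_eq_zero_iff by metis
  show ?thesis
    unfolding finite_dense_def using fin Ac dense by (intro conjI) auto
qed

lemma (in cring) tau_q_von_neumann_regular_mod_nilradical: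
  assumes "q_dim R = 0"
  shows "tau_q_von_neumann_regular (R Quot nilradical R)"
proof -
  let ?N = "nilradical R"
  let ?S = "R Quot ?N"
  interpret N: ideal ?N R by (rule ideal_nilradical)
  interpret S: cring ?S by (rule N.quotient_is_cring[OF is_cring])
  interpret h: ring_hom_ring R ?S "(+>) ?N" by (rule N.rcos_ring_hom_ring)
  have "von_neumann_regular (localization_at ?S M)" if M: "M \<in> q_Max ?S" for M
  proof (rule von_neumann_regular_localization_at[OF S.is_cring S.q_MaxD(1)[OF M]])
    interpret M: primeideal M ?S by (rule S.q_MaxD(1)[OF M])
    \<comment> \<open>The preimage of \<open>M\<close> is not semi-regular, because finite dense
      sets in it would stay dense in the quotient and lie in \<open>M\<close>.\<close>
    define P where "P = {r \<in> carrier R. ?N +> r \<in> M}"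
    have iP: "ideal P R" unfolding P_def by (rule h.ideal_vimage[OF M.ideal_axioms])
    have pP: "primeideal P R"
    proof (rule primeidealI[OF iP is_cring])
      have "\<one>\<^bsub>?S\<^esub> \<notin> M" using M.one_imp_carrier M.I_notcarr by blast
      then have "\<one> \<notin> P" unfolding P_def using h.hom_one by simp
      then show "carrier R \<noteq> P" by blast
      show "a \<in> P \<or> b \<in> P" if "a \<in> carrier R" "b \<in> carrier R" "a \<otimes> b \<in> P" for a b
        using that M.I_prime[of "?N +> a" "?N +> b"] by (auto simp: P_def)
    qed
    have "\<not> semiregular_ideal R P"
    proof
      assume "semiregular_ideal R P"
      then obtain A where A: "finite_dense R A" "A \<subseteq> P" using semiregular_ideal_iff[OF iP] by blast
      then have "(+>) ?N ` A \<subseteq> M" by (auto simp: P_def)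
      then have "semiregular_ideal ?S M"
        using finite_dense_mod_nilradical[OF A(1)] S.semiregular_ideal_iff[OF M.ideal_axioms] by blast
      then show False using S.q_MaxD(2)[OF M] by blast
    qed
    then obtain Q where "Q \<in> q_Max R" "P \<subseteq> Q"
      using not_semiregular_subset_q_Max[OF iP] by blast
    \<comment> \<open>The prime \<open>P\<close> lies in a maximal q-ideal, which is a minimal
      prime, so the two coincide.\<close>
    then have minP: "P \<in> minimal_primes R"
      using q_Max_subset_minimal_primes[OF assms] pP unfolding minimal_primes_def by blast
    fix X assume X: "X \<in> M"
    then obtain r where r: "r \<in> carrier R" "X = ?N +> r" using N.FactRing_carrier_rcos M.Icarr by blast
    then have "r \<in> P" using X by (simp add: P_def)
    then obtain s n where s: "s \<in> carrier R - P" "s \<otimes> r [^] (n::nat) = \<zero>"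
      using minimal_prime_annihilator[OF minP] by blast
    \<comment> \<open>Only one factor \<open>s\<close> is needed to kill \<open>r [^] n\<close>; the
      exponent \<open>Suc n\<close> supplies it even for \<open>n = 0\<close>.\<close>
    have "(s \<otimes> r) [^] Suc n = (s [^] n \<otimes> r) \<otimes> (s \<otimes> r [^] n)"
      using s(1) r(1) by (simp add: nat_pow_distrib m_ac)
    also have "\<dots> = \<zero>" using s r(1) by simp
    finally have "s \<otimes> r \<in> ?N" using s(1) r(1) unfolding nilradical_def by blast
    then have "(?N +> s) \<otimes>\<^bsub>?S\<^esub> X = \<zero>\<^bsub>?S\<^esub>" 
      using N.rcos_eq_zero_iff s(1) r by (simp flip: h.hom_mult)
    moreover have "?N +> s \<in> carrier ?S - M" using s(1) by (auto simp: P_def)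
    ultimately show "\<exists>t\<in>carrier ?S - M. t \<otimes>\<^bsub>?S\<^esub> X = \<zero>\<^bsub>?S\<^esub>" by blast
  qed
  then show ?thesis using S.is_cring by (auto simp: tau_q_von_neumann_regular_def)
qed

theorem proposition2p4:
  fixes R :: "('a, 'b) ring_scheme"
  assumes "cring R"
    and "q_dim R = 0"
  shows "tau_q_von_neumann_regular (R Quot nilradical R)
    \<and> compact_space (subtopology (zariski_topology R) (minimal_primes R))"
  using cring.tau_q_von_neumann_regular_mod_nilradical[OF assms]
    compact_space_subtopology[OF cring.compactin_minimal_primes[OF assms]] by (rule conjI)

end
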